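(* Let $p\geq 3$ be an odd prime and let $\zeta_p:\{\xi\in\mathbb{Z}:\gcd(\xi,p)=1\}\to\{0,1\}$ be a function such that (1) if $\gcd(\theta_1,p)=\gcd(\theta_2,p)=1$ and $\theta_1\equiv\theta_2\pmod p$, then $\zeta_p(\theta_1)=\zeta_p(\theta_2)$; (2) the sets $A_i=\{a:\zeta_p(a)=i,\ 1\leq a\leq p-1\}$, $i=0,1$, satisfy $|A_0|=|A_1|=\frac{p-1}{2}$; and (3) $\zeta_p(\theta)=\frac{1+\chi_p(\theta)}{2}$ for a function $\chi_p:\{\xi\in\mathbb{Z}:\gcd(\xi,p)=1\}\to\{-1,1\}$ satisfying $\chi_p(\theta_1\theta_2)=\chi_p(\theta_1)\chi_p(\theta_2)$ for all $\theta_1,\theta_2$ relatively prime to $p$. Let $G$ be a simple connected graph of order $\frac{p-1}{2}$ and size $\frac{p-1}{2}+\epsilon$, where $\epsilon\in\{-1,0,1\}$, and let $S=\{1,2,\ldots,p-1\}$. Then the corona graph $G\circ K_1$ is an arithmetic cordial graph modulo $p$ under $\langle S,\zeta_p,\cdot\rangle$, where $\cdot$ is ordinary multiplication of integers.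
   Context: The order of a graph is its number of vertices and its size is its number of edges. $K_1$ is the one-vertex graph. Corona graph: $G\circ H$ is obtained from one copy of $G$ and $|V(G)|$ disjoint copies of $H$ by joining every vertex of the $i$th copy of $H$ to the $i$th vertex of $G$. Arithmetic cordial graph: let $\eta$ be a positive integer, $S\subseteq\mathbb{Z}$, $\star:S\times S\to\mathbb{Z}$ a binary function, and $\zeta_\eta:\{\xi\in\mathbb{Z}:\gcd(\xi,\eta)=1\}\to\{0,1\}$ a function. The triple $\langle S,\zeta_\eta,\star\rangle$ is called an arithmetic structure. For a simple connected graph $\Gamma$ of order $N$, a bijection $f:V(\Gamma)\to S$ (where $|S|=N$) is an arithmetic cordial labeling modulo $\eta$ under $\langle S,\zeta_\eta,\star\rangle$ if the induced function $f_\eta^*:E(\Gamma)\to\{0,1\}$, defined by $f_\eta^*(ab)=0$ if $\gcd(f(a)\star f(b),\eta)\neq 1$ or $\zeta_\eta(f(a)\star f(b))=0$, and $f_\eta^*(ab)=1$ if $\gcd(f(a)\star f(b),\eta)=1$ and $\zeta_\eta(f(a)\star f(b))=1$, satisfies $|e_{f_\eta^*}(0)-e_{f_\eta^*}(1)|\leq 1$, where $e_{f_\eta^*}(i)$ is the number of edges with label $i$. A graph admitting such a labeling is an arithmetic cordial graph modulo $\eta$ under $\langle S,\zeta_\eta,\star\rangle$. *)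

theory Defs
  imports
    Complex_Main
    "HOL-Library.FuncSet"
    "HOL-Computational_Algebra.Primes"
    "Graph_Theory.Digraph_Component"
begin

text \<open>
  Undirected simple graphs are finite symmetric loop-free digraphs without parallel arcs
  (\<^locale>\<open>pair_graph\<close>). Each undirected edge is represented by two opposite arcs, so edges
  are counted as two-element sets of vertices and not as arcs.
\<close>

definition simple_connected_graph :: "'a pair_pre_digraph \<Rightarrow> bool" where
  "simple_connected_graph G \<longleftrightarrow> pair_graph G \<and> Digraph_Component.connected (with_proj G)"

definition graph_edges :: "'a pair_pre_digraph \<Rightarrow> 'a set set" where
  "graph_edges G = {{u, v} | u v. (u, v) \<in> parcs G}"

definition graph_order :: "'a pair_pre_digraph \<Rightarrow> nat" where
  "graph_order G = card (pverts G)"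

definition graph_size :: "'a pair_pre_digraph \<Rightarrow> nat" where
  "graph_size G = card (graph_edges G)"

definition K1 :: "unit pair_pre_digraph" where
  "K1 = \<lparr> pverts = {()}, parcs = {} \<rparr>"

text \<open>
  \<open>Inl w\<close> is the vertex \<open>w\<close> of the copy of \<open>G\<close>, and \<open>Inr (w, x)\<close> is the vertex \<open>x\<close> of the copy
  of \<open>H\<close> attached to \<open>w\<close>.
\<close>

definition corona ::
  "'a pair_pre_digraph \<Rightarrow> 'b pair_pre_digraph \<Rightarrow> ('a + 'a \<times> 'b) pair_pre_digraph" where
  "corona G H = \<lparr>
     pverts = Inl ` pverts G \<union> Inr ` (pverts G \<times> pverts H),
     parcs = {(Inl u, Inl v) | u v. (u, v) \<in> parcs G}
           \<union> {(Inr (w, x), Inr (w, y)) | w x y. w \<in> pverts G \<and> (x, y) \<in> parcs H}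
           \<union> {(Inl w, Inr (w, x)) | w x. w \<in> pverts G \<and> x \<in> pverts H}
           \<union> {(Inr (w, x), Inl w) | w x. w \<in> pverts G \<and> x \<in> pverts H} \<rparr>"

text \<open>
  Partial functions are total functions constrained only on their domain: \<open>\<zeta>\<close> matters only on
  the integers coprime to \<open>\<eta>\<close>, and the operation \<open>star\<close> only on \<open>S \<times> S\<close>. Since \<open>S\<close> and \<open>star\<close> are unrestricted apart from
  their types, they impose no condition in the following definition.
\<close>

definition arithmetic_structure ::
  "nat \<Rightarrow> int set \<Rightarrow> (int \<Rightarrow> nat) \<Rightarrow> (int \<Rightarrow> int \<Rightarrow> int) \<Rightarrow> bool" where
  "arithmetic_structure \<eta> S \<zeta> star \<longleftrightarrow>
     \<eta> > 0 \<and> \<zeta> \<in> {\<xi>. coprime \<xi> (int \<eta>)} \<rightarrow> {0, 1}"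

definition induced_label ::
  "nat \<Rightarrow> (int \<Rightarrow> nat) \<Rightarrow> (int \<Rightarrow> int \<Rightarrow> int) \<Rightarrow> ('a \<Rightarrow> int) \<Rightarrow> 'a \<Rightarrow> 'a \<Rightarrow> nat" where
  "induced_label \<eta> \<zeta> star f a b =
     (if \<not> coprime (star (f a) (f b)) (int \<eta>) \<or> \<zeta> (star (f a) (f b)) = 0 then 0 else 1)"

definition label_count ::
  "nat \<Rightarrow> (int \<Rightarrow> nat) \<Rightarrow> (int \<Rightarrow> int \<Rightarrow> int) \<Rightarrow> 'a pair_pre_digraph \<Rightarrow> ('a \<Rightarrow> int) \<Rightarrow> nat \<Rightarrow> nat"
  where
  "label_count \<eta> \<zeta> star \<Gamma> f i =
     card {{a, b} | a b. (a, b) \<in> parcs \<Gamma> \<and> induced_label \<eta> \<zeta> star f a b = i}"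

text \<open>
  The second conjunct says that the induced labeling is well defined on undirected edges; it
  holds automatically when \<open>star\<close> is commutative on \<open>S\<close>.
\<close>

definition arithmetic_cordial_labeling ::
  "nat \<Rightarrow> int set \<Rightarrow> (int \<Rightarrow> nat) \<Rightarrow> (int \<Rightarrow> int \<Rightarrow> int) \<Rightarrow> 'a pair_pre_digraph \<Rightarrow> ('a \<Rightarrow> int) \<Rightarrow> bool"
  where
  "arithmetic_cordial_labeling \<eta> S \<zeta> star \<Gamma> f \<longleftrightarrow>
     bij_betw f (pverts \<Gamma>) S \<and>
     (\<forall>(a, b)\<in>parcs \<Gamma>. induced_label \<eta> \<zeta> star f a b = induced_label \<eta> \<zeta> star f b a) \<and>
     \<bar>int (label_count \<eta> \<zeta> star \<Gamma> f 0) - int (label_count \<eta> \<zeta> star \<Gamma> f 1)\<bar> \<le> 1"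

definition arithmetic_cordial_graph ::
  "nat \<Rightarrow> int set \<Rightarrow> (int \<Rightarrow> nat) \<Rightarrow> (int \<Rightarrow> int \<Rightarrow> int) \<Rightarrow> 'a pair_pre_digraph \<Rightarrow> bool" where
  "arithmetic_cordial_graph \<eta> S \<zeta> star \<Gamma> \<longleftrightarrow>
     arithmetic_structure \<eta> S \<zeta> star \<and> simple_connected_graph \<Gamma> \<and>
     (\<exists>f. arithmetic_cordial_labeling \<eta> S \<zeta> star \<Gamma> f)"

end

theory Submission
  imports Defs
begin

text \<open>
  Let \<open>n = (p - 1) / 2\<close>. The sign \<open>\<chi>\<close> splits the labels \<open>1, \<dots>, p - 1\<close> into two halves of \<open>n\<close>
  elements each, and \<open>G\<circ>K\<^sub>1\<close> also consists of two halves: the \<open>n\<close> vertices of \<open>G\<close> and the \<open>n\<close>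
  pendant vertices. Put the labels of sign \<open>1\<close> on \<open>G\<close> and those of sign \<open>-1\<close> on the pendant
  vertices, in any order. No product of two labels is divisible by \<open>p\<close>, so the label of an edge
  is determined by the product of the signs of its ends. Hence every edge of \<open>G\<close> has label \<open>1\<close>
  and every pendant edge has label \<open>0\<close>. There are \<open>n + \<epsilon>\<close> edges of the first kind and \<open>n\<close> of the
  second, and the counts differ by \<open>\<bar>\<epsilon>\<bar> \<le> 1\<close>.

  The counting is done in \<open>label_counts_corona_K1\<close> for an arbitrary labeling that is constant
  on each of the two kinds of edges; \<open>label_mult_of_sign\<close> provides this constancy. As a cordial
  graph is required to be simple and connected, the same has to be shown for the corona
  (\<open>simple_connected_graph_corona\<close>).
\<close>

lemma simple_connected_graph_iff_rtrancl:
  "simple_connected_graph G \<longleftrightarrow>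
     pair_graph G \<and> pverts G \<noteq> {} \<and> (\<forall>u\<in>pverts G. \<forall>v\<in>pverts G. (u, v) \<in> (parcs G)\<^sup>*)"
proof (cases "pair_graph G")
  case True
  then interpret pair_graph G .
  have "(parcs G)\<^sup>s = parcs G"
    using pair_sym_arcs by (auto simp: symcl_def symmetric_def dest: symD)
  moreover have "(u, v) \<in> rtrancl_on (pverts G) (parcs G) \<longleftrightarrow> (u, v) \<in> (parcs G)\<^sup>*"
    if "u \<in> pverts G" for u v
    using reachable_conv'[of u v] that by (simp add: reachable_def)
  ultimately show ?thesis
    using True by (simp add: simple_connected_graph_def connected_conv)
qed (simp add: simple_connected_graph_def)

lemma pair_graph_corona:
  assumes "pair_graph G" and "pair_graph H"
  shows "pair_graph (corona G H)"
proof -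
  interpret G: pair_graph G by fact
  interpret H: pair_graph H by fact
  let ?C = "corona G H"
  have sub: "parcs ?C \<subseteq> pverts ?C \<times> pverts ?C"
    by (auto simp: corona_def dest: G.wellformed' H.wellformed')
  have fin: "finite (pverts ?C)"
    using G.pair_finite_verts H.pair_finite_verts by (simp add: corona_def)
  have "finite (parcs ?C)"
    using finite_subset[OF sub] fin by simp
  moreover have "sym (parcs ?C)"
    using G.pair_sym_arcs H.pair_sym_arcs
    by (auto simp: corona_def sym_def symmetric_def)
  moreover have "fst e \<noteq> snd e" if "e \<in> parcs ?C" for e
    using that G.pair_no_loops H.pair_no_loops by (fastforce simp: corona_def)
  ultimately show ?thesis
    using sub fin by unfold_locales (auto simp: symmetric_def)
qed

lemma simple_connected_graph_corona:
  assumes G: "simple_connected_graph G" and H: "pair_graph H"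
  shows "simple_connected_graph (corona G H)"
proof -
  let ?C = "corona G H"
  have pG: "pair_graph G" and ne: "pverts G \<noteq> {}"
    and conn: "\<And>u v. u \<in> pverts G \<Longrightarrow> v \<in> pverts G \<Longrightarrow> (u, v) \<in> (parcs G)\<^sup>*"
    using G by (auto simp: simple_connected_graph_iff_rtrancl)
  have lift: "(Inl u, Inl v) \<in> (parcs ?C)\<^sup>*" if "(u, v) \<in> (parcs G)\<^sup>*" for u v
    using that
  proof induction
    case (step v w)
    then have "(Inl v, Inl w) \<in> parcs ?C" by (auto simp: corona_def)
    with step.IH show ?case by (rule rtrancl_into_rtrancl)
  qed simp
  \<comment> \<open>Every vertex of a copy of \<open>H\<close> is one step away from the vertex of \<open>G\<close> it is attached to, so
      a walk in the corona can be routed through the copy of \<open>G\<close>.\<close>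
  have root: "\<exists>w\<in>pverts G. (x, Inl w) \<in> (parcs ?C)\<^sup>* \<and> (Inl w, x) \<in> (parcs ?C)\<^sup>*"
    if "x \<in> pverts ?C" for x
    using that by (fastforce simp: corona_def)
  have "(x, y) \<in> (parcs ?C)\<^sup>*" if "x \<in> pverts ?C" "y \<in> pverts ?C" for x y
    using root[OF that(1)] root[OF that(2)] by (meson conn lift rtrancl_trans)
  moreover have "pverts ?C \<noteq> {}"
    using ne by (simp add: corona_def)
  ultimately show ?thesis
    using pair_graph_corona[OF pG H] by (simp add: simple_connected_graph_iff_rtrancl)
qed

lemma pair_graph_K1: "pair_graph K1"
  by unfold_locales (auto simp: K1_def symmetric_def sym_def)

lemma arc_corona_K1_iff:
  "(a, b) \<in> parcs (corona G K1) \<longleftrightarrow>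
     (\<exists>u v. a = Inl u \<and> b = Inl v \<and> (u, v) \<in> parcs G)
     \<or> (\<exists>w\<in>pverts G. a = Inl w \<and> b = Inr (w, ()) \<or> a = Inr (w, ()) \<and> b = Inl w)"
  by (auto simp: corona_def K1_def)

lemma label_counts_corona_K1:
  assumes core: "\<And>u v. (u, v) \<in> parcs G \<Longrightarrow> induced_label \<eta> \<zeta> star f (Inl u) (Inl v) = 1"
    and pendant: "\<And>w. w \<in> pverts G \<Longrightarrow> induced_label \<eta> \<zeta> star f (Inl w) (Inr (w, ())) = 0"
      "\<And>w. w \<in> pverts G \<Longrightarrow> induced_label \<eta> \<zeta> star f (Inr (w, ())) (Inl w) = 0"
  shows "label_count \<eta> \<zeta> star (corona G K1) f 1 = graph_size G"
    and "label_count \<eta> \<zeta> star (corona G K1) f 0 = graph_order G"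
proof -
  let ?C = "corona G K1" and ?l = "induced_label \<eta> \<zeta> star f"
  have one: "(a, b) \<in> parcs ?C \<and> ?l a b = 1 \<longleftrightarrow>
      (\<exists>u v. a = Inl u \<and> b = Inl v \<and> (u, v) \<in> parcs G)" for a b
    using core pendant by (force simp: arc_corona_K1_iff)
  have zero: "(a, b) \<in> parcs ?C \<and> ?l a b = 0 \<longleftrightarrow>
      (\<exists>w\<in>pverts G. a = Inl w \<and> b = Inr (w, ()) \<or> a = Inr (w, ()) \<and> b = Inl w)" for a b
    using core pendant by (force simp: arc_corona_K1_iff)
  have "{{a, b} | a b. (a, b) \<in> parcs ?C \<and> ?l a b = 1} = {{Inl u, Inl v} | u v. (u, v) \<in> parcs G}"
    unfolding one by blast
  also have "\<dots> = {Inl ` {u, v} | u v. (u, v) \<in> parcs G}"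
    by simp
  also have "\<dots> = (`) Inl ` graph_edges G"
    unfolding graph_edges_def by blast
  finally show "label_count \<eta> \<zeta> star ?C f 1 = graph_size G"
    by (simp add: label_count_def graph_size_def card_image inj_on_def inj_image_eq_iff)
  have "{{a, b} | a b. (a, b) \<in> parcs ?C \<and> ?l a b = 0} = (\<lambda>w. {Inl w, Inr (w, ())}) ` pverts G"
    unfolding zero by (blast intro: insert_commute)
  moreover have "inj_on (\<lambda>w. {Inl w, Inr (w, ())}) (pverts G)"
    by (auto simp: inj_on_def doubleton_eq_iff)
  ultimately show "label_count \<eta> \<zeta> star ?C f 0 = graph_order G"
    by (simp add: label_count_def graph_order_def card_image)
qed

text \<open>
  With \<open>\<zeta> = (1 + \<chi>) / 2\<close>, the values \<open>0\<close> and \<open>1\<close> of \<open>\<zeta>\<close> encode the signs \<open>-1\<close> and \<open>1\<close> of \<open>\<chi>\<close>, so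
  the multiplicativity of \<open>\<chi>\<close> turns into a parity rule for the labels of the edges.
\<close>

lemma label_mult_of_sign:
  fixes \<zeta> :: "int \<Rightarrow> nat" and \<chi> :: "int \<Rightarrow> int"
  assumes chi_mult: "\<And>x y. coprime x (int \<eta>) \<Longrightarrow> coprime y (int \<eta>) \<Longrightarrow> \<chi> (x * y) = \<chi> x * \<chi> y"
    and zeta_chi: "\<And>x. coprime x (int \<eta>) \<Longrightarrow> real (\<zeta> x) = (1 + real_of_int (\<chi> x)) / 2"
    and coprime: "coprime (f a) (int \<eta>)" "coprime (f b) (int \<eta>)"
    and range: "\<zeta> (f a) \<in> {0, 1}" "\<zeta> (f b) \<in> {0, 1}"
  shows "induced_label \<eta> \<zeta> (*) f a b = (if \<zeta> (f a) = \<zeta> (f b) then 1 else 0)"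
proof -
  have chi: "\<chi> x = 2 * int (\<zeta> x) - 1" if "coprime x (int \<eta>)" for x
  proof -
    have "real_of_int (\<chi> x) = real_of_int (2 * int (\<zeta> x) - 1)"
      using zeta_chi[OF that] by simp
    then show ?thesis
      by (simp only: of_int_eq_iff)
  qed
  have cop: "coprime (f a * f b) (int \<eta>)"
    using coprime by simp
  have "2 * int (\<zeta> (f a * f b)) - 1 = (2 * int (\<zeta> (f a)) - 1) * (2 * int (\<zeta> (f b)) - 1)"
    using chi_mult[OF coprime] by (simp only: chi cop coprime)
  then have "\<zeta> (f a * f b) = (if \<zeta> (f a) = \<zeta> (f b) then 1 else 0)"
    using range by auto
  then show ?thesis
    using cop by (simp add: induced_label_def)
qed

theorem theorem5p4:
  fixes p :: nat and \<zeta> :: "int \<Rightarrow> nat" and \<chi> :: "int \<Rightarrow> int"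
    and G :: "'a pair_pre_digraph" and \<epsilon> :: int
  assumes "prime p" and "odd p" and "p \<ge> 3"
    and zeta_range: "\<zeta> \<in> {\<xi>. coprime \<xi> (int p)} \<rightarrow> {0, 1}"
    and zeta_cong: "\<And>\<theta>1 \<theta>2. coprime \<theta>1 (int p) \<Longrightarrow> coprime \<theta>2 (int p) \<Longrightarrow>
          \<theta>1 mod int p = \<theta>2 mod int p \<Longrightarrow> \<zeta> \<theta>1 = \<zeta> \<theta>2"
    and card_A0: "card {a::int. 1 \<le> a \<and> a \<le> int p - 1 \<and> \<zeta> a = 0} = (p - 1) div 2"
    and card_A1: "card {a::int. 1 \<le> a \<and> a \<le> int p - 1 \<and> \<zeta> a = 1} = (p - 1) div 2"
    and chi_range: "\<chi> \<in> {\<xi>. coprime \<xi> (int p)} \<rightarrow> {-1, 1}"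
    and chi_mult: "\<And>\<theta>1 \<theta>2. coprime \<theta>1 (int p) \<Longrightarrow> coprime \<theta>2 (int p) \<Longrightarrow>
          \<chi> (\<theta>1 * \<theta>2) = \<chi> \<theta>1 * \<chi> \<theta>2"
    and zeta_chi: "\<And>\<theta>. coprime \<theta> (int p) \<Longrightarrow>
          real (\<zeta> \<theta>) = (1 + real_of_int (\<chi> \<theta>)) / 2"
    and G_graph: "simple_connected_graph G"
    and G_order: "graph_order G = (p - 1) div 2"
    and eps: "\<epsilon> \<in> {-1, 0, 1}"
    and G_size: "int (graph_size G) = int ((p - 1) div 2) + \<epsilon>"
  shows "arithmetic_cordial_graph p {1..int p - 1} \<zeta> (*) (corona G K1)"
proof -
  define A where "A i = {a::int. 1 \<le> a \<and> a \<le> int p - 1 \<and> \<zeta> a = i}" for i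
  let ?S = "{1..int p - 1}" and ?C = "corona G K1"
  have pG: "pair_graph G"
    using G_graph by (simp add: simple_connected_graph_def)
  then interpret pair_graph G .
  have cop: "coprime a (int p)" if "a \<in> ?S" for a
  proof -
    have "\<not> int p dvd a"
      using that zdvd_not_zless[of a "int p"] by auto
    then show ?thesis
      using \<open>prime p\<close> prime_imp_coprime[of "int p" a] by (simp add: coprime_commute)
  qed
  have finA: "finite (A i)" for i
    by (rule finite_subset[of _ ?S]) (auto simp: A_def)
  have cardA: "card (A 0) = card (pverts G)" "card (A 1) = card (pverts G)"
    using card_A0 card_A1 G_order by (simp_all add: A_def graph_order_def)
  have split: "?S = A 1 \<union> A 0"
  proof -
    have "\<zeta> a \<in> {0, 1}" if "a \<in> ?S" for a
      using zeta_range cop[OF that] by auto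
    then show ?thesis by (fastforce simp: A_def)
  qed
  obtain g h where g: "bij_betw g (pverts G) (A 1)" and h: "bij_betw h (pverts G) (A 0)"
    using finite_same_card_bij[OF pair_finite_verts finA] cardA by metis
  define f :: "'a + 'a \<times> unit \<Rightarrow> int" where "f = case_sum g (h \<circ> fst)"
  have gA: "g v \<in> A 1" and hA: "h v \<in> A 0" if "v \<in> pverts G" for v
    using that g h by (auto dest: bij_betwE)
  have bij: "bij_betw f (pverts ?C) ?S"
  proof -
    have "bij_betw f (Inl ` pverts G) (A 1)"
      using g by (simp add: f_def bij_betw_def inj_on_def image_image)
    moreover have "bij_betw f (Inr ` (pverts G \<times> {()})) (A 0)"
      using h by (auto simp: f_def bij_betw_def inj_on_def image_iff) (metis imageE)
    ultimately have "bij_betw f (Inl ` pverts G \<union> Inr ` (pverts G \<times> {()})) (A 1 \<union> A 0)"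
      by (rule bij_betw_combine) (auto simp: A_def)
    then show ?thesis
      by (simp add: corona_def K1_def split)
  qed
  have label: "induced_label p \<zeta> (*) f a b = (if \<zeta> (f a) = \<zeta> (f b) then 1 else 0)"
    if "f a \<in> ?S" "f b \<in> ?S" for a b
  proof (rule label_mult_of_sign[of p \<chi> \<zeta>])
    show "\<zeta> (f a) \<in> {0, 1}" "\<zeta> (f b) \<in> {0, 1}"
      using that zeta_range cop by auto
  qed (use that cop chi_mult zeta_chi in auto)
  have balanced: "\<bar>int (label_count p \<zeta> (*) ?C f 0) - int (label_count p \<zeta> (*) ?C f 1)\<bar> \<le> 1"
  proof -
    have S: "g v \<in> ?S" "h v \<in> ?S" "\<zeta> (g v) = 1" "\<zeta> (h v) = 0" if "v \<in> pverts G" for v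
      using gA[OF that] hA[OF that] by (auto simp: A_def)
    have core: "induced_label p \<zeta> (*) f (Inl u) (Inl v) = 1" if "(u, v) \<in> parcs G" for u v
      using wellformed'[OF that] S label[of "Inl u" "Inl v"] by (simp add: f_def)
    have pendant: "induced_label p \<zeta> (*) f (Inl w) (Inr (w, ())) = 0"
        "induced_label p \<zeta> (*) f (Inr (w, ())) (Inl w) = 0" if "w \<in> pverts G" for w
      using S[OF that] label[of "Inl w" "Inr (w, ())"] label[of "Inr (w, ())" "Inl w"]
      by (simp_all add: f_def)
    have "label_count p \<zeta> (*) ?C f 1 = graph_size G"
         "label_count p \<zeta> (*) ?C f 0 = graph_order G"
      using label_counts_corona_K1[of G p \<zeta> "(*)" f, OF core pendant] by simp_all
    then show ?thesis
      using eps G_order G_size by auto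
  qed
  have "induced_label p \<zeta> (*) f a b = induced_label p \<zeta> (*) f b a" for a b
    by (simp add: induced_label_def mult.commute)
  then have "arithmetic_cordial_labeling p ?S \<zeta> (*) ?C f"
    using bij balanced by (auto simp: arithmetic_cordial_labeling_def)
  moreover have "arithmetic_structure p ?S \<zeta> (*)"
    using zeta_range \<open>p \<ge> 3\<close> by (simp add: arithmetic_structure_def)
  ultimately show ?thesis
    using simple_connected_graph_corona[OF G_graph pair_graph_K1]
    by (auto simp: arithmetic_cordial_graph_def)
qed

end
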